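(* Let $\pi\colon(X,T)\to(Y,S)$ be a factor map between two minimal dynamical systems. If $\pi$ is proximal but not almost one-to-one, then $(X,T)$ is $n$-tuplewise IP-sensitive for every $n\ge 2$.
   Context: A dynamical system is a pair $(X,T)$ where $X$ is a compact metric space with metric $d$ and $T\colon X\to X$ is a continuous surjection. $\mathbb{N}$ is the set of positive integers. A subsystem is a non-empty closed $Y\subset X$ with $TY\subset Y$; a system is minimal if it has no proper subsystem. A factor map $\pi\colon(X,T)\to(Y,S)$ is a continuous surjection with $\pi\circ T=S\circ\pi$. A pair $(x,y)\in X^2$ is proximal if $\liminf_{k\to\infty}d(T^kx,T^ky)=0$. The factor map $\pi$ is proximal if every pair $(x,y)$ with $\pi(x)=\pi(y)$ is proximal; it is almost one-to-one if $\{x\in X:\pi^{-1}(\pi(x))\text{ is a singleton}\}$ is residual in $X$ (contains a dense $G_\delta$ set). A set $F\subset\mathbb{N}$ is an IP-set if there is a sequence $(p_i)_{i\ge1}$ in $\mathbb{N}$ such that $\sum_{i\in\alpha}p_i\in F$ for every non-empty finite $\alpha\subset\mathbb{N}$. For $n\ge2$, $(X,T)$ is $n$-tuplewise IP-sensitive if there is a constant $\delta>0$ such that for every non-empty open $U\subset X$ there exist $x_1,\dots,x_n\in U$ such that $\{k\in\mathbb{N}: \min_{1\le i<j\le n}d(T^kx_i,T^kx_j)>\delta\}$ is an IP-set. *)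

theory Defs
  imports "HOL-Analysis.Analysis"
begin

text \<open>
  A compact metric space is a compact set \<open>X\<close> in a type of class \<open>metric_space\<close>, with
  the metric \<open>dist\<close>; maps are total functions of which only the values on \<open>X\<close> matter.
  Open, closed and dense are meant relative to \<open>X\<close>.
\<close>

definition dynamical_system :: "'a::metric_space set \<Rightarrow> ('a \<Rightarrow> 'a) \<Rightarrow> bool" where
  "dynamical_system X T \<longleftrightarrow> compact X \<and> continuous_on X T \<and> T ` X = X"

definition subsystem :: "'a::metric_space set \<Rightarrow> ('a \<Rightarrow> 'a) \<Rightarrow> 'a set \<Rightarrow> bool" where
  "subsystem X T Z \<longleftrightarrow> Z \<noteq> {} \<and> closedin (top_of_set X) Z \<and> T ` Z \<subseteq> Z"

definition minimal_system :: "'a::metric_space set \<Rightarrow> ('a \<Rightarrow> 'a) \<Rightarrow> bool" where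
  "minimal_system X T \<longleftrightarrow>
     dynamical_system X T \<and> \<not> (\<exists>Z. subsystem X T Z \<and> Z \<noteq> X)"

definition factor_map ::
    "'a::metric_space set \<Rightarrow> ('a \<Rightarrow> 'a) \<Rightarrow> 'b::metric_space set \<Rightarrow> ('b \<Rightarrow> 'b) \<Rightarrow> ('a \<Rightarrow> 'b) \<Rightarrow> bool"
  where
  "factor_map X T Y S \<pi> \<longleftrightarrow>
     continuous_on X \<pi> \<and> \<pi> ` X = Y \<and> (\<forall>x\<in>X. \<pi> (T x) = S (\<pi> x))"

text \<open>
  The lower limit is taken in \<open>ereal\<close> because \<open>liminf\<close> requires a complete lattice.
\<close>

definition proximal_pair :: "('a::metric_space \<Rightarrow> 'a) \<Rightarrow> 'a \<Rightarrow> 'a \<Rightarrow> bool" where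
  "proximal_pair T x y \<longleftrightarrow> liminf (\<lambda>k. ereal (dist ((T ^^ k) x) ((T ^^ k) y))) = 0"

definition proximal_map :: "'a::metric_space set \<Rightarrow> ('a \<Rightarrow> 'a) \<Rightarrow> ('a \<Rightarrow> 'b) \<Rightarrow> bool" where
  "proximal_map X T \<pi> \<longleftrightarrow> (\<forall>x\<in>X. \<forall>y\<in>X. \<pi> x = \<pi> y \<longrightarrow> proximal_pair T x y)"

definition residual_in :: "'a topology \<Rightarrow> 'a set \<Rightarrow> bool" where
  "residual_in \<tau> A \<longleftrightarrow>
     A \<subseteq> topspace \<tau> \<and> (\<exists>G. gdelta_in \<tau> G \<and> \<tau> closure_of G = topspace \<tau> \<and> G \<subseteq> A)"

definition almost_one_to_one :: "'a::metric_space set \<Rightarrow> ('a \<Rightarrow> 'b) \<Rightarrow> bool" where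
  "almost_one_to_one X \<pi> \<longleftrightarrow>
     residual_in (top_of_set X) {x \<in> X. is_singleton {x' \<in> X. \<pi> x' = \<pi> x}}"

text \<open>
  The positive integers are the subset \<open>{1..}\<close> of \<open>nat\<close>; the value \<open>p 0\<close> plays no role.
\<close>

definition IP_set :: "nat set \<Rightarrow> bool" where
  "IP_set F \<longleftrightarrow> F \<subseteq> {1..} \<and>
     (\<exists>p :: nat \<Rightarrow> nat. (\<forall>i\<ge>1. p i \<ge> 1) \<and>
        (\<forall>\<alpha>. finite \<alpha> \<and> \<alpha> \<noteq> {} \<and> \<alpha> \<subseteq> {1..} \<longrightarrow> (\<Sum>i\<in>\<alpha>. p i) \<in> F))"

text \<open>
  Intended for \<open>n \<ge> 2\<close> only: for smaller \<open>n\<close> the minimum is over an empty set.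
\<close>

definition tuplewise_IP_sensitive :: "nat \<Rightarrow> 'a::metric_space set \<Rightarrow> ('a \<Rightarrow> 'a) \<Rightarrow> bool" where
  "tuplewise_IP_sensitive n X T \<longleftrightarrow>
     (\<exists>\<delta>>0. \<forall>U. openin (top_of_set X) U \<and> U \<noteq> {} \<longrightarrow>
        (\<exists>x :: nat \<Rightarrow> 'a. (\<forall>i\<in>{1..n}. x i \<in> U) \<and>
           IP_set {k \<in> {1..}.
             Min {dist ((T ^^ k) (x i)) ((T ^^ k) (x j)) |i j. 1 \<le> i \<and> i < j \<and> j \<le> n} > \<delta>}))"

end

theory Submission
  imports Defs
begin

text \<open>
  A tuple \<open>T^q\<^sub>1 z, \<dots>, T^q\<^sub>n z\<close> of points of one orbit returns close to itself simultaneously with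
  bounded gaps. If \<open>x\<^sub>i\<close> lies in the fibre of \<open>T^q\<^sub>i z\<close>, then proximality, being uniform on the
  compact relation \<open>\<pi> a = \<pi> b\<close>, brings all pairs \<open>(x\<^sub>i, T^q\<^sub>i z)\<close> together at a common time, so that
  the \<open>x\<^sub>i\<close> and the \<open>T^q\<^sub>i z\<close> have common return times to a neighbourhood of the \<open>T^q\<^sub>i z\<close>; iterating
  gives an IP-set of them. As \<open>\<pi>\<close> is semi-open, \<open>\<pi> ` U\<close> contains an open set \<open>W\<close>, and by minimality
  it only remains to see that the preimage of every such \<open>W\<close> contains \<open>n\<close> points whose separation is
  bounded below independently of \<open>W\<close>. For \<open>n = 2\<close> this is Baire's theorem applied to the failure of
  \<open>\<pi>\<close> to be almost one-to-one; each further point comes from proximality, which would otherwise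
  merge two of the clusters of a preimage. Since \<open>T\<close> and \<open>S\<close> need not be invertible, sets are pulled back
  using the irreducibility of minimal maps.
\<close>

lemma IP_set_mono:
  assumes "IP_set F" "F \<subseteq> G" "G \<subseteq> {1..}"
  shows "IP_set G"
proof -
  from assms(1) obtain p :: "nat \<Rightarrow> nat" where p: "\<forall>i\<ge>1. p i \<ge> 1"
    "\<forall>\<alpha>. finite \<alpha> \<and> \<alpha> \<noteq> {} \<and> \<alpha> \<subseteq> {1..} \<longrightarrow> sum p \<alpha> \<in> F"
    unfolding IP_set_def by auto
  with assms(2) have "\<forall>\<alpha>. finite \<alpha> \<and> \<alpha> \<noteq> {} \<and> \<alpha> \<subseteq> {1..} \<longrightarrow> sum p \<alpha> \<in> G"
    by (meson subsetD)
  with p(1) assms(3) show ?thesis unfolding IP_set_def by (intro conjI exI[of _ p])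
qed

lemma IP_setI_extend:
  assumes F: "F \<subseteq> {1..}"
    and ext: "\<And>A. finite A \<Longrightarrow> A \<subseteq> insert 0 F \<Longrightarrow> \<exists>p\<ge>1. \<forall>s\<in>A. p + s \<in> F"
  shows "IP_set F"
proof -
  obtain g :: "nat set \<Rightarrow> nat"
    where g: "\<And>A. finite A \<Longrightarrow> A \<subseteq> insert 0 F \<Longrightarrow> g A \<ge> 1 \<and> (\<forall>s\<in>A. g A + s \<in> F)"
    using ext by metis
  define A where "A = rec_nat {0::nat} (\<lambda>_ B. B \<union> (+) (g B) ` B)"
  define p where "p n = g (A n)" for n
  have A_0: "A 0 = {0}" and A_Suc: "A (Suc n) = A n \<union> (+) (p n) ` A n" for n
    by (simp_all add: A_def p_def)
  have A: "finite (A n) \<and> A n \<subseteq> insert 0 F" for n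
  proof (induction n)
    case 0
    show ?case by (simp add: A_0)
  next
    case (Suc n)
    then show ?case using g[of "A n"] by (auto simp: A_Suc p_def)
  qed
  have sums: "sum p \<alpha> \<in> A n" if "\<alpha> \<subseteq> {..<n}" for \<alpha> n
    using that
  proof (induction n arbitrary: \<alpha>)
    case 0
    then show ?case by (simp add: A_0)
  next
    case (Suc n)
    then have fin: "finite \<alpha>" using finite_subset by blast
    have "sum p (\<alpha> - {n}) \<in> A n"
      using Suc.prems by (intro Suc.IH) (auto simp: less_Suc_eq)
    then show ?case
      using sum.remove[OF fin, of n p] by (cases "n \<in> \<alpha>") (auto simp: A_Suc)
  qed
  have "sum p \<alpha> \<in> F" if "finite \<alpha>" "\<alpha> \<noteq> {}" for \<alpha>
  proof -
    let ?m = "Max \<alpha>"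
    have "sum p (\<alpha> - {?m}) \<in> A ?m"
    proof (rule sums)
      show "\<alpha> - {?m} \<subseteq> {..<?m}" using that Max_ge[of \<alpha>] by (auto simp: order.strict_iff_order)
    qed
    then show ?thesis
      using g[of "A ?m"] A[of ?m] sum.remove[OF that(1) Max_in[OF that], of p] by (simp add: p_def)
  qed
  moreover have "p i \<ge> 1" for i using g A by (simp add: p_def)
  ultimately show ?thesis using F unfolding IP_set_def by blast
qed

definition small_cover :: "nat \<Rightarrow> real \<Rightarrow> 'a::metric_space set \<Rightarrow> bool" where
  "small_cover m \<delta> A \<longleftrightarrow> (\<exists>\<B>. finite \<B> \<and> card \<B> \<le> m \<and> A \<subseteq> \<Union>\<B> \<and>
     (\<forall>B\<in>\<B>. \<forall>a\<in>B. \<forall>b\<in>B. dist a b < \<delta>))"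

lemma separated_points_if_no_small_cover:
  fixes A :: "'a::metric_space set"
  assumes no: "\<not> small_cover m \<delta> A" and "j \<le> Suc m"
  shows "\<exists>x. (\<forall>i\<in>{1..j}. x i \<in> A) \<and> (\<forall>i l. 1 \<le> i \<and> i < l \<and> l \<le> j \<longrightarrow> dist (x i) (x l) \<ge> \<delta> / 2)"
  using \<open>j \<le> Suc m\<close>
proof (induction j)
  case 0
  show ?case by auto
next
  case (Suc j)
  then obtain x where x: "\<forall>i\<in>{1..j}. x i \<in> A"
    "\<And>i l. 1 \<le> i \<Longrightarrow> i < l \<Longrightarrow> l \<le> j \<Longrightarrow> dist (x i) (x l) \<ge> \<delta> / 2" by auto
  let ?\<B> = "(\<lambda>i. ball (x i) (\<delta> / 2)) ` {1..j}"
  have "finite ?\<B>" "card ?\<B> \<le> m"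
    using card_image_le[of "{1..j}" "\<lambda>i. ball (x i) (\<delta> / 2)"] Suc.prems by auto
  moreover have "\<forall>B\<in>?\<B>. \<forall>a\<in>B. \<forall>b\<in>B. dist a b < \<delta>"
    by (auto intro: dist_triangle_half_r)
  ultimately have "A \<subseteq> \<Union>?\<B> \<Longrightarrow> small_cover m \<delta> A"
    unfolding small_cover_def by (intro exI[of _ ?\<B>] conjI)
  then have "\<not> A \<subseteq> \<Union>?\<B>" using no by blast
  then obtain c where c: "c \<in> A" "\<forall>i\<in>{1..j}. \<not> dist (x i) c < \<delta> / 2"
    by (force simp only: subset_iff UN_iff mem_ball)
  show ?case
    by (rule exI[of _ "x(Suc j := c)"]) (use x c in \<open>auto simp: le_Suc_eq not_less\<close>)
qed

locale minimal_dynamics =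
  fixes X :: "'a::metric_space set" and T :: "'a \<Rightarrow> 'a"
  assumes minimal: "minimal_system X T"
begin

lemma compact: "compact X" and continuous: "continuous_on X T" and surj: "T ` X = X"
  using minimal by (auto simp: minimal_system_def dynamical_system_def)

lemma funpow_in [simp]: "x \<in> X \<Longrightarrow> (T ^^ k) x \<in> X"
  by (induction k) (use surj in auto)

lemma continuous_funpow: "continuous_on X (T ^^ k)"
proof (induction k)
  case 0
  show ?case by (simp add: id_def)
next
  case (Suc k)
  have "continuous_on ((T ^^ k) ` X) T"
    by (rule continuous_on_subset[OF continuous]) auto
  from continuous_on_compose[OF Suc this] show ?case by simp
qed

lemma surj_funpow: "(T ^^ k) ` X = X"
proof (induction k)
  case (Suc k)
  have "(T ^^ Suc k) ` X = T ` ((T ^^ k) ` X)" by auto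
  then show ?case by (simp only: Suc surj)
qed simp

lemma openin_funpow_vimage:
  "openin (top_of_set X) V \<Longrightarrow> openin (top_of_set X) (X \<inter> (T ^^ k) -` V)"
  using continuous_openin_preimage[OF continuous_funpow, of k X V] by simp

lemma bounded_visit:
  assumes V: "openin (top_of_set X) V" "V \<noteq> {}"
  obtains L where "\<And>x. x \<in> X \<Longrightarrow> \<exists>l\<le>L. (T ^^ l) x \<in> V"
proof -
  let ?P = "\<lambda>l. X \<inter> (T ^^ l) -` V"
  define C where "C = X - (\<Union>l. ?P l)"
  have "closedin (top_of_set X) C"
    unfolding C_def by (intro closedin_diff openin_Union) (auto simp: openin_funpow_vimage V)
  moreover have "T ` C \<subseteq> C"
  proof clarify
    fix x assume x: "x \<in> C"
    have "(T ^^ l) (T x) \<notin> V" for l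
    proof -
      have "(T ^^ Suc l) x \<notin> V" using x by (simp add: C_def del: funpow.simps)
      then show ?thesis by (simp add: funpow_swap1)
    qed
    then show "T x \<in> C" using x surj by (auto simp: C_def)
  qed
  moreover have "C \<noteq> X"
  proof -
    obtain v where "v \<in> V" using V by auto
    then have "v \<in> X" "v \<notin> C" using openin_subset[OF V(1)] by (auto simp: C_def intro!: exI[of _ 0])
    then show ?thesis by auto
  qed
  ultimately have "C = {}" using minimal by (auto simp: minimal_system_def subsystem_def)
  then have "X \<subseteq> \<Union>(range ?P)" by (auto simp: C_def)
  moreover have "\<forall>c\<in>range ?P. openin (top_of_set X) c" using openin_funpow_vimage V by auto
  ultimately obtain D where D: "D \<subseteq> range ?P" "finite D" "X \<subseteq> \<Union>D"
    using compact unfolding compact_eq_openin_cover by meson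
  then obtain I where I: "finite I" "D = ?P ` I" using finite_subset_image[OF D(2,1)] by auto
  then obtain L where L: "\<forall>i\<in>I. i \<le> L" using finite_nat_set_iff_bounded_le by blast
  have "\<exists>l\<le>L. (T ^^ l) x \<in> V" if "x \<in> X" for x
  proof -
    have "x \<in> \<Union>(?P ` I)" using that D(3) I(2) by auto
    then show ?thesis using L by auto
  qed
  then show thesis by (rule that)
qed

text \<open>A backward orbit inside a closed proper subset would never visit its complement.\<close>

lemma irreducible:
  assumes A: "closedin (top_of_set X) A" and im: "T ` A = X"
  shows "A = X"
proof (rule ccontr)
  assume "A \<noteq> X"
  then have "openin (top_of_set X) (X - A)" "X - A \<noteq> {}"
    using A closedin_subset by (auto simp: closedin_def)
  from bounded_visit[OF this] obtain L where L: "\<And>x. x \<in> X \<Longrightarrow> \<exists>l\<le>L. (T ^^ l) x \<in> X - A"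
    by metis
  have AX: "A \<subseteq> X" using closedin_subset[OF A] by simp
  have pre: "\<exists>x\<in>X. (T ^^ j) x = w \<and> (\<forall>i<j. (T ^^ i) x \<in> A)" if "w \<in> X" for j w
    using that
  proof (induction j arbitrary: w)
    case (Suc j)
    obtain a where a: "a \<in> A" "T a = w" using Suc.prems im by auto
    with Suc.IH[of a] AX obtain x where "x \<in> X" "(T ^^ j) x = a" "\<forall>i<j. (T ^^ i) x \<in> A"
      by blast
    with a show ?case by (auto simp: less_Suc_eq intro!: bexI[of _ x])
  qed auto
  obtain w where "w \<in> X" using \<open>X - A \<noteq> {}\<close> by auto
  from pre[OF this, of "Suc L"] L show False by (auto simp: less_Suc_eq_le)
qed

lemma preimage_contained:
  assumes "openin (top_of_set X) V" "V \<noteq> {}"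
  obtains W where "openin (top_of_set X) W" "W \<noteq> {}" "\<And>x. x \<in> X \<Longrightarrow> (T ^^ k) x \<in> W \<Longrightarrow> x \<in> V"
proof -
  have "\<exists>W. openin (top_of_set X) W \<and> W \<noteq> {} \<and> (\<forall>x\<in>X. (T ^^ k) x \<in> W \<longrightarrow> x \<in> V)"
    using assms
  proof (induction k arbitrary: V)
    case 0
    then show ?case by auto
  next
    case (Suc k)
    define V1 where "V1 = X - T ` (X - V)"
    have cl: "closedin (top_of_set X) (X - V)" using Suc.prems by (intro closedin_diff) auto
    then have "compact (X - V)" using compact closedin_compact by blast
    then have "compact (T ` (X - V))"
      by (rule compact_continuous_image[rotated]) (rule continuous_on_subset[OF continuous], auto)
    then have "openin (top_of_set X) V1"
      unfolding V1_def using compact_imp_closed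
      by (intro openin_diff closed_subset) (use surj in auto)
    moreover have "V1 \<noteq> {}"
    proof
      assume "V1 = {}"
      then have "T ` (X - V) = X" using surj by (auto simp: V1_def)
      from irreducible[OF cl this] openin_subset[OF Suc.prems(1)] Suc.prems(2) show False by auto
    qed
    ultimately obtain W where W: "openin (top_of_set X) W" "W \<noteq> {}"
      "\<forall>x\<in>X. (T ^^ k) x \<in> W \<longrightarrow> x \<in> V1" using Suc.IH by metis
    have "x \<in> V" if "x \<in> X" "(T ^^ Suc k) x \<in> W" for x
    proof -
      have "T x \<in> V1" using W(3) that funpow_in[of x 1] by (simp add: funpow_swap1)
      then show ?thesis using that by (auto simp: V1_def)
    qed
    then show ?case using W by blast
  qed
  then show thesis using that by blast
qed

lemma uniform_equicontinuity:
  assumes "\<epsilon> > 0"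
  obtains \<delta> where "\<delta> > 0"
    "\<And>a b k. a \<in> X \<Longrightarrow> b \<in> X \<Longrightarrow> dist a b < \<delta> \<Longrightarrow> k \<le> K \<Longrightarrow> dist ((T ^^ k) a) ((T ^^ k) b) < \<epsilon>"
proof -
  have "\<exists>\<delta>>0. \<forall>a\<in>X. \<forall>b\<in>X. \<forall>k\<le>K. dist a b < \<delta> \<longrightarrow> dist ((T ^^ k) a) ((T ^^ k) b) < \<epsilon>"
  proof (induction K)
    case 0
    show ?case using assms by auto
  next
    case (Suc K)
    then obtain \<delta> where d: "\<delta> > 0"
      "\<forall>a\<in>X. \<forall>b\<in>X. \<forall>k\<le>K. dist a b < \<delta> \<longrightarrow> dist ((T ^^ k) a) ((T ^^ k) b) < \<epsilon>" by auto
    have "uniformly_continuous_on X (T ^^ Suc K)"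
      by (rule compact_uniformly_continuous[OF continuous_funpow compact])
    then obtain \<delta>' where d': "\<delta>' > 0"
      "\<forall>a\<in>X. \<forall>b\<in>X. dist b a < \<delta>' \<longrightarrow> dist ((T ^^ Suc K) b) ((T ^^ Suc K) a) < \<epsilon>"
      unfolding uniformly_continuous_on_def using assms by metis
    show ?case
    proof (intro exI conjI ballI allI impI)
      show "min \<delta> \<delta>' > 0" using d d' by simp
      fix a b k assume "a \<in> X" "b \<in> X" "k \<le> Suc K" "dist a b < min \<delta> \<delta>'"
      then show "dist ((T ^^ k) a) ((T ^^ k) b) < \<epsilon>"
        using d(2) d'(2) by (cases "k = Suc K") auto
    qed
  qed
  then show thesis using that by blast
qed

end

locale minimal_factor = X: minimal_dynamics X T + Y: minimal_dynamics Y S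
  for X :: "'a::metric_space set" and T and Y :: "'b::metric_space set" and S +
  fixes \<pi> :: "'a \<Rightarrow> 'b"
  assumes factor: "factor_map X T Y S \<pi>"
begin

lemma pi_continuous: "continuous_on X \<pi>" and pi_surj: "\<pi> ` X = Y"
  using factor by (auto simp: factor_map_def)

lemma pi_in [simp]: "x \<in> X \<Longrightarrow> \<pi> x \<in> Y"
  using pi_surj by auto

lemma pi_funpow: "x \<in> X \<Longrightarrow> \<pi> ((T ^^ k) x) = (S ^^ k) (\<pi> x)"
  by (induction k) (use factor in \<open>auto simp: factor_map_def\<close>)

lemma openin_pi_vimage: "openin (top_of_set Y) W \<Longrightarrow> openin (top_of_set X) (X \<inter> \<pi> -` W)"
  using continuous_openin_preimage[OF pi_continuous, of Y W] by simp

lemma pi_semiopen: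
  assumes U: "openin (top_of_set X) U" "U \<noteq> {}"
  obtains W where "openin (top_of_set Y) W" "W \<noteq> {}" "W \<subseteq> \<pi> ` U"
proof -
  obtain u where u: "u \<in> U" "u \<in> X" using U openin_subset by fastforce
  then obtain e where e: "e > 0" "cball u e \<inter> X \<subseteq> U"
    using U(1) unfolding openin_contains_cball by blast
  define C where "C = X \<inter> cball u e"
  define D where "D = Y - \<pi> ` C"
  have "compact C" unfolding C_def by (intro compact_Int_closed X.compact closed_cball)
  then have "compact (\<pi> ` C)"
    by (rule compact_continuous_image[rotated]) (rule continuous_on_subset[OF pi_continuous], auto simp: C_def)
  then have D: "openin (top_of_set Y) D"
    unfolding D_def using compact_imp_closed by (intro openin_diff closed_subset) (auto simp: C_def)
  obtain L where L: "\<And>x. x \<in> X \<Longrightarrow> \<exists>l\<le>L. (T ^^ l) x \<in> X \<inter> ball u e"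
    by (rule X.bounded_visit[of "X \<inter> ball u e"]) (use u e in \<open>auto simp: openin_open_Int\<close>)
  have "\<exists>W. openin (top_of_set Y) W \<and> W \<noteq> {} \<and> W \<inter> D = {}"
  proof (rule ccontr)
    assume "\<not> ?thesis"
    then have dense: "W \<inter> D \<noteq> {}" if "openin (top_of_set Y) W" "W \<noteq> {}" for W using that by blast
    have "\<exists>V. openin (top_of_set Y) V \<and> V \<noteq> {} \<and> (\<forall>y\<in>V. \<forall>k<K. (S ^^ k) y \<in> D)" for K
    proof (induction K)
      case 0
      have "Y \<noteq> {}" using pi_in[OF u(2)] by auto
      then show ?case by (intro exI[of _ Y]) auto
    next
      case (Suc K)
      then obtain V where V: "openin (top_of_set Y) V" "V \<noteq> {}" "\<forall>y\<in>V. \<forall>k<K. (S ^^ k) y \<in> D"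
        by blast
      obtain W where W: "openin (top_of_set Y) W" "W \<noteq> {}" "\<And>y. y \<in> Y \<Longrightarrow> (S ^^ K) y \<in> W \<Longrightarrow> y \<in> V"
        using Y.preimage_contained[OF V(1,2), of K] by blast
      from dense[OF W(1,2)] obtain w where w: "w \<in> W" "w \<in> D" by auto
      then have "w \<in> (S ^^ K) ` Y" by (simp add: Y.surj_funpow D_def)
      then obtain y where "y \<in> Y" "(S ^^ K) y = w" by auto
      with w W(3)[of y] have "y \<in> V \<inter> (Y \<inter> (S ^^ K) -` D)" by auto
      moreover have "openin (top_of_set Y) (V \<inter> (Y \<inter> (S ^^ K) -` D))"
        by (rule openin_Int[OF V(1) Y.openin_funpow_vimage[OF D]])
      moreover have "\<forall>y\<in>V \<inter> (Y \<inter> (S ^^ K) -` D). \<forall>k<Suc K. (S ^^ k) y \<in> D"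
        using V(3) by (auto simp: less_Suc_eq)
      ultimately show ?case by blast
    qed
    from this[of "Suc L"] obtain V where V: "openin (top_of_set Y) V" "V \<noteq> {}"
      "\<forall>y\<in>V. \<forall>k<Suc L. (S ^^ k) y \<in> D" by blast
    then obtain y where y: "y \<in> Y" "\<And>k. k < Suc L \<Longrightarrow> (S ^^ k) y \<in> D"
      using openin_subset[OF V(1)] by auto
    then obtain x where x: "x \<in> X" "\<pi> x = y" using pi_surj by auto
    from L[OF x(1)] obtain l where "l \<le> L" "(T ^^ l) x \<in> C" by (auto simp: C_def)
    moreover have "\<pi> ((T ^^ l) x) \<in> D"
      using y(2)[of l] \<open>l \<le> L\<close> pi_funpow[OF x(1), of l] x(2) by simp
    ultimately show False by (auto simp: D_def)
  qed
  then obtain W where W: "openin (top_of_set Y) W" "W \<noteq> {}" "W \<inter> D = {}" by blast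
  show thesis
  proof (rule that[OF W(1,2)])
    have "W \<subseteq> \<pi> ` C" using W(3) openin_subset[OF W(1)] by (auto simp: D_def)
    also have "\<dots> \<subseteq> \<pi> ` U" using e by (auto simp: C_def)
    finally show "W \<subseteq> \<pi> ` U" .
  qed
qed

lemma convergent_pair:
  assumes "\<And>n. f n \<in> X" "\<And>n. g n \<in> X"
  obtains a b and r :: "nat \<Rightarrow> nat" where "a \<in> X" "b \<in> X" "strict_mono r"
    "(\<lambda>n. f (r n)) \<longlonglongrightarrow> a" "(\<lambda>n. g (r n)) \<longlonglongrightarrow> b"
proof -
  have "seq_compact (X \<times> X)" by (intro compact_imp_seq_compact compact_Times X.compact)
  moreover have "\<forall>n. (f n, g n) \<in> X \<times> X" using assms by auto
  ultimately obtain l r where "l \<in> X \<times> X" and r: "strict_mono (r :: nat \<Rightarrow> nat)"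
    and lim: "((\<lambda>n. (f n, g n)) \<circ> r) \<longlonglongrightarrow> l"
    by (rule seq_compactE)
  then have "fst l \<in> X" "snd l \<in> X" by auto
  from that[OF this r] tendsto_fst[OF lim] tendsto_snd[OF lim] show thesis
    by (simp add: o_def)
qed

lemma separated_preimages_transport:
  assumes W0: "openin (top_of_set Y) W0" "W0 \<noteq> {}" and "\<delta>0 > 0"
    and sep: "\<And>W. openin (top_of_set Y) W \<Longrightarrow> W \<noteq> {} \<Longrightarrow> W \<subseteq> W0 \<Longrightarrow>
      \<exists>a\<in>X \<inter> \<pi> -` W. \<exists>b\<in>X \<inter> \<pi> -` W. dist a b \<ge> \<delta>0"
  obtains \<delta> where "\<delta> > 0"
    "\<And>W. openin (top_of_set Y) W \<Longrightarrow> W \<noteq> {} \<Longrightarrow>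
      \<exists>a\<in>X \<inter> \<pi> -` W. \<exists>b\<in>X \<inter> \<pi> -` W. dist a b \<ge> \<delta>"
proof -
  obtain K where K: "\<And>y. y \<in> Y \<Longrightarrow> \<exists>k\<le>K. (S ^^ k) y \<in> W0"
    using Y.bounded_visit[OF W0] by blast
  obtain \<delta> where \<delta>: "\<delta> > 0" "\<And>a b k. a \<in> X \<Longrightarrow> b \<in> X \<Longrightarrow> dist a b < \<delta> \<Longrightarrow> k \<le> K
      \<Longrightarrow> dist ((T ^^ k) a) ((T ^^ k) b) < \<delta>0"
    using X.uniform_equicontinuity[OF \<open>\<delta>0 > 0\<close>, of K] by blast
  show thesis
  proof (rule that[OF \<delta>(1)])
    fix W assume W: "openin (top_of_set Y) W" "W \<noteq> {}"
    then obtain y where y: "y \<in> W" "y \<in> Y" using openin_subset[OF W(1)] by auto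
    with K obtain k where k: "k \<le> K" "(S ^^ k) y \<in> W0" by blast
    have "openin (top_of_set Y) (W \<inter> (Y \<inter> (S ^^ k) -` W0))"
      by (rule openin_Int[OF W(1) Y.openin_funpow_vimage[OF W0(1)]])
    moreover have "W \<inter> (Y \<inter> (S ^^ k) -` W0) \<noteq> {}" using y k by auto
    ultimately obtain V where V: "openin (top_of_set Y) V" "V \<noteq> {}"
      "\<And>y. y \<in> Y \<Longrightarrow> (S ^^ k) y \<in> V \<Longrightarrow> y \<in> W \<inter> (Y \<inter> (S ^^ k) -` W0)"
      using Y.preimage_contained[of "W \<inter> (Y \<inter> (S ^^ k) -` W0)" k] by blast
    have "V \<subseteq> W0"
    proof
      fix v assume v: "v \<in> V"
      then have "v \<in> (S ^^ k) ` Y" using openin_subset[OF V(1)] by (auto simp: Y.surj_funpow)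
      with V(3) v show "v \<in> W0" by auto
    qed
    from sep[OF V(1,2) this] obtain a b where
      ab: "a \<in> X" "b \<in> X" "\<pi> a \<in> V" "\<pi> b \<in> V" "dist a b \<ge> \<delta>0" by auto
    have "a \<in> (T ^^ k) ` X" "b \<in> (T ^^ k) ` X" using ab X.surj_funpow by auto
    then obtain a' b' where a': "a' \<in> X" "(T ^^ k) a' = a" and b': "b' \<in> X" "(T ^^ k) b' = b"
      by auto
    have "\<pi> a' \<in> W" "\<pi> b' \<in> W"
      using V(3)[of "\<pi> a'"] V(3)[of "\<pi> b'"] pi_funpow[of a' k] pi_funpow[of b' k] a' b' ab by auto
    moreover have "\<not> dist a' b' < \<delta>" using \<delta>(2)[of a' b' k] a' b' k ab by auto
    ultimately show "\<exists>a\<in>X \<inter> \<pi> -` W. \<exists>b\<in>X \<inter> \<pi> -` W. dist a b \<ge> \<delta>"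
      using a' b' by (intro bexI[of _ a'] bexI[of _ b']) auto
  qed
qed

lemma separated_preimages_some_open:
  assumes "\<not> almost_one_to_one X \<pi>"
  obtains W0 \<delta> where "openin (top_of_set Y) W0" "W0 \<noteq> {}" "\<delta> > 0"
    "\<And>W. openin (top_of_set Y) W \<Longrightarrow> W \<noteq> {} \<Longrightarrow> W \<subseteq> W0 \<Longrightarrow>
      \<exists>a\<in>X \<inter> \<pi> -` W. \<exists>b\<in>X \<inter> \<pi> -` W. dist a b \<ge> \<delta>"
proof -
  define G where "G m = \<Union>{W. openin (top_of_set Y) W \<and>
    (\<forall>a\<in>X \<inter> \<pi> -` W. \<forall>b\<in>X \<inter> \<pi> -` W. dist a b < inverse (real (Suc m)))}" for m
  define H where "H m = X \<inter> \<pi> -` G m" for m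
  have openH: "openin (top_of_set X) (H m)" for m
    unfolding H_def by (intro openin_pi_vimage) (auto simp: G_def)
  have "\<exists>m. top_of_set X closure_of H m \<noteq> topspace (top_of_set X)"
  proof (rule ccontr)
    assume "\<not> ?thesis"
    then have "\<And>D. D \<in> range H \<Longrightarrow> openin (top_of_set X) D \<and> top_of_set X closure_of D = topspace (top_of_set X)"
      using openH by auto
    moreover have "locally_compact_space (top_of_set X)" "regular_space (top_of_set X)"
      using X.compact
      by (auto simp: compact_space_subtopology Hausdorff_space_subtopology
          intro!: compact_imp_locally_compact_space compact_Hausdorff_imp_regular_space)
    ultimately have "top_of_set X closure_of \<Inter>(range H) = topspace (top_of_set X)"
      by (intro Baire_category) auto
    moreover have "gdelta_in (top_of_set X) (\<Inter>(range H))"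
      by (intro gdelta_in_Inter) (auto intro: open_imp_gdelta_in openH)
    moreover have "\<Inter>(range H) \<subseteq> {x \<in> X. is_singleton {x' \<in> X. \<pi> x' = \<pi> x}}"
    proof
      fix x assume x: "x \<in> \<Inter>(range H)"
      then have "x \<in> X" by (auto simp: H_def)
      moreover have "x' = x" if x': "x' \<in> X" "\<pi> x' = \<pi> x" for x'
      proof (rule ccontr)
        assume "x' \<noteq> x"
        then obtain m where m: "inverse (real (Suc m)) < dist x' x"
          using reals_Archimedean[of "dist x' x"] by auto
        have "\<pi> x \<in> G m" using x by (auto simp: H_def)
        then obtain W where "\<pi> x \<in> W" "\<forall>a\<in>X \<inter> \<pi> -` W. \<forall>b\<in>X \<inter> \<pi> -` W. dist a b < inverse (real (Suc m))"
          unfolding G_def by blast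
        then have "dist x' x < inverse (real (Suc m))" using x' \<open>x \<in> X\<close> by auto
        with m show False by simp
      qed
      ultimately have "{x' \<in> X. \<pi> x' = \<pi> x} = {x}" by auto
      with \<open>x \<in> X\<close> show "x \<in> {x \<in> X. is_singleton {x' \<in> X. \<pi> x' = \<pi> x}}" by auto
    qed
    ultimately have "almost_one_to_one X \<pi>"
      unfolding almost_one_to_one_def residual_in_def by auto
    with assms show False by simp
  qed
  then obtain m U where U: "openin (top_of_set X) U" "U \<noteq> {}" "H m \<inter> U = {}"
    unfolding dense_intersects_open by blast
  obtain W0 where W0: "openin (top_of_set Y) W0" "W0 \<noteq> {}" "W0 \<subseteq> \<pi> ` U"
    using pi_semiopen[OF U(1,2)] by blast
  show thesis
  proof (rule that[OF W0(1,2)])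
    show "inverse (real (Suc m)) > 0" by simp
    fix W assume W: "openin (top_of_set Y) W" "W \<noteq> {}" "W \<subseteq> W0"
    show "\<exists>a\<in>X \<inter> \<pi> -` W. \<exists>b\<in>X \<inter> \<pi> -` W. dist a b \<ge> inverse (real (Suc m))"
    proof (rule ccontr)
      assume "\<not> ?thesis"
      then have "\<forall>a\<in>X \<inter> \<pi> -` W. \<forall>b\<in>X \<inter> \<pi> -` W. dist a b < inverse (real (Suc m))"
        by (meson not_le)
      with W(1) have "W \<subseteq> G m" unfolding G_def by blast
      moreover obtain u where "u \<in> U" "\<pi> u \<in> W" using W W0(3) by blast
      moreover have "U \<subseteq> X" using openin_subset[OF U(1)] by simp
      ultimately have "u \<in> H m \<inter> U" by (auto simp: H_def)
      with U(3) show False by simp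
    qed
  qed
qed

lemma separated_fibres:
  assumes "\<not> almost_one_to_one X \<pi>"
  obtains \<delta> where "\<delta> > 0"
    "\<And>W. openin (top_of_set Y) W \<Longrightarrow> W \<noteq> {} \<Longrightarrow>
      \<exists>a\<in>X. \<exists>b\<in>X. \<pi> a = \<pi> b \<and> \<pi> a \<in> W \<and> dist a b \<ge> \<delta>"
proof -
  obtain W0 \<delta>0 where "openin (top_of_set Y) W0" "W0 \<noteq> {}" "\<delta>0 > 0"
    "\<And>W. openin (top_of_set Y) W \<Longrightarrow> W \<noteq> {} \<Longrightarrow> W \<subseteq> W0 \<Longrightarrow>
      \<exists>a\<in>X \<inter> \<pi> -` W. \<exists>b\<in>X \<inter> \<pi> -` W. dist a b \<ge> \<delta>0"
    using separated_preimages_some_open[OF assms] by blast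
  from separated_preimages_transport[OF this]
  obtain \<delta> where \<delta>: "\<delta> > 0" "\<And>W. openin (top_of_set Y) W \<Longrightarrow> W \<noteq> {} \<Longrightarrow>
      \<exists>a\<in>X \<inter> \<pi> -` W. \<exists>b\<in>X \<inter> \<pi> -` W. dist a b \<ge> \<delta>"
    by blast
  show thesis
  proof (rule that[OF \<delta>(1)])
    fix W assume W: "openin (top_of_set Y) W" "W \<noteq> {}"
    then obtain y where y: "y \<in> W" "y \<in> Y" using openin_subset[OF W(1)] by auto
    have "\<exists>a b. a \<in> X \<and> b \<in> X \<and> dist (\<pi> a) y < inverse (real (Suc n)) \<and>
        dist (\<pi> b) y < inverse (real (Suc n)) \<and> dist a b \<ge> \<delta>" for n
    proof -
      have "openin (top_of_set Y) (Y \<inter> ball y (inverse (real (Suc n))))"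
        by (simp add: openin_open_Int)
      moreover have "Y \<inter> ball y (inverse (real (Suc n))) \<noteq> {}" using y by auto
      ultimately show ?thesis using \<delta>(2) by (fastforce simp: dist_commute)
    qed
    then obtain f g where fg: "\<And>n. f n \<in> X" "\<And>n. g n \<in> X"
      "\<And>n. dist (\<pi> (f n)) y < inverse (real (Suc n))" "\<And>n. dist (\<pi> (g n)) y < inverse (real (Suc n))"
      "\<And>n. dist (f n) (g n) \<ge> \<delta>" by metis
    obtain a b and r :: "nat \<Rightarrow> nat" where lim: "a \<in> X" "b \<in> X" "strict_mono r"
      "(\<lambda>n. f (r n)) \<longlonglongrightarrow> a" "(\<lambda>n. g (r n)) \<longlonglongrightarrow> b"
      using convergent_pair[of f g, OF fg(1,2)] by blast
    have limit_over: "\<pi> c = y" if h: "\<And>n. h n \<in> X" "\<And>n. dist (\<pi> (h n)) y < inverse (real (Suc n))"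
      and c: "c \<in> X" "(\<lambda>n. h (r n)) \<longlonglongrightarrow> c" for h c
    proof (rule LIMSEQ_unique)
      show "(\<lambda>n. \<pi> (h (r n))) \<longlonglongrightarrow> \<pi> c"
        by (rule continuous_on_tendsto_compose[OF pi_continuous c(2,1)]) (simp add: h)
      have "(\<lambda>n. \<pi> (h n)) \<longlonglongrightarrow> y"
        using h(2) by (intro metric_tendsto_imp_tendsto[OF LIMSEQ_inverse_real_of_nat])
          (auto intro!: always_eventually less_imp_le)
      from LIMSEQ_subseq_LIMSEQ[OF this lim(3)] show "(\<lambda>n. \<pi> (h (r n))) \<longlonglongrightarrow> y"
        by (simp add: o_def)
    qed
    have "dist a b \<ge> \<delta>"
      by (rule LIMSEQ_le_const[OF tendsto_dist[OF lim(4,5)]]) (use fg(5) in auto)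
    moreover have "\<pi> a = y" "\<pi> b = y"
      using limit_over[OF fg(1,3) lim(1,4)] limit_over[OF fg(2,4) lim(2,5)] by auto
    ultimately show "\<exists>a\<in>X. \<exists>b\<in>X. \<pi> a = \<pi> b \<and> \<pi> a \<in> W \<and> dist a b \<ge> \<delta>"
      using lim(1,2) y by (intro bexI[of _ a] bexI[of _ b]) auto
  qed
qed

end

locale proximal_minimal_factor = minimal_factor X T Y S \<pi>
  for X :: "'a::metric_space set" and T and Y :: "'b::metric_space set" and S \<pi> +
  assumes proximal: "proximal_map X T \<pi>"
begin

lemma uniform_proximality:
  assumes "\<eta> > 0"
  obtains K where "\<And>a b. a \<in> X \<Longrightarrow> b \<in> X \<Longrightarrow> \<pi> a = \<pi> b \<Longrightarrow>
    \<exists>k\<le>K. dist ((T ^^ k) a) ((T ^^ k) b) < \<eta>"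
proof (rule ccontr)
  assume "\<not> thesis"
  then have "\<exists>a b. a \<in> X \<and> b \<in> X \<and> \<pi> a = \<pi> b \<and> (\<forall>k\<le>K. dist ((T ^^ k) a) ((T ^^ k) b) \<ge> \<eta>)" for K
    using that[of K] by (meson not_le)
  then obtain f g where fg: "\<And>n. f n \<in> X" "\<And>n. g n \<in> X" "\<And>n. \<pi> (f n) = \<pi> (g n)"
    "\<And>n k. k \<le> n \<Longrightarrow> dist ((T ^^ k) (f n)) ((T ^^ k) (g n)) \<ge> \<eta>" by metis
  obtain a b and r :: "nat \<Rightarrow> nat" where lim: "a \<in> X" "b \<in> X" "strict_mono r"
    "(\<lambda>n. f (r n)) \<longlonglongrightarrow> a" "(\<lambda>n. g (r n)) \<longlonglongrightarrow> b"
    using convergent_pair[of f g, OF fg(1,2)] by blast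
  have "(\<lambda>n. \<pi> (f (r n))) \<longlonglongrightarrow> \<pi> a"
    by (rule continuous_on_tendsto_compose[OF pi_continuous lim(4,1)]) (simp add: fg)
  moreover have "(\<lambda>n. \<pi> (g (r n))) \<longlonglongrightarrow> \<pi> b"
    by (rule continuous_on_tendsto_compose[OF pi_continuous lim(5,2)]) (simp add: fg)
  ultimately have "\<pi> a = \<pi> b" using LIMSEQ_unique by (simp add: fg(3)) blast
  then have prox: "proximal_pair T a b" using proximal lim by (simp add: proximal_map_def)
  have "\<exists>k. dist ((T ^^ k) a) ((T ^^ k) b) < \<eta>"
  proof (rule ccontr)
    assume "\<not> ?thesis"
    then have "ereal \<eta> \<le> liminf (\<lambda>k. ereal (dist ((T ^^ k) a) ((T ^^ k) b)))"
      by (intro Liminf_bounded always_eventually) (auto simp: not_less)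
    with prox assms show False by (simp add: proximal_pair_def)
  qed
  then obtain k where k: "dist ((T ^^ k) a) ((T ^^ k) b) < \<eta>" by blast
  have "(\<lambda>n. dist ((T ^^ k) (f (r n))) ((T ^^ k) (g (r n)))) \<longlonglongrightarrow> dist ((T ^^ k) a) ((T ^^ k) b)"
    by (intro tendsto_dist continuous_on_tendsto_compose[OF X.continuous_funpow] lim) (simp_all add: fg)
  moreover have "\<eta> \<le> dist ((T ^^ k) (f (r n))) ((T ^^ k) (g (r n)))" if "n \<ge> k" for n
    using fg(4)[of k "r n"] seq_suble[OF lim(3), of n] that by simp
  ultimately have "\<eta> \<le> dist ((T ^^ k) a) ((T ^^ k) b)"
    by (intro LIMSEQ_le_const) auto
  with k show False by simp
qed

lemma simultaneous_proximality:
  assumes "finite I" "\<And>i. i \<in> I \<Longrightarrow> a i \<in> X \<and> b i \<in> X \<and> \<pi> (a i) = \<pi> (b i)" "\<eta> > 0"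
  shows "\<exists>k. \<forall>i\<in>I. dist ((T ^^ k) (a i)) ((T ^^ k) (b i)) < \<eta>"
  using assms
proof (induction I arbitrary: \<eta> rule: finite_induct)
  case (insert j I)
  obtain K where K: "\<And>a b. a \<in> X \<Longrightarrow> b \<in> X \<Longrightarrow> \<pi> a = \<pi> b \<Longrightarrow>
      \<exists>k\<le>K. dist ((T ^^ k) a) ((T ^^ k) b) < \<eta>"
    using uniform_proximality[OF insert.prems(2)] by blast
  obtain \<rho> where \<rho>: "\<rho> > 0" "\<And>a b k. a \<in> X \<Longrightarrow> b \<in> X \<Longrightarrow> dist a b < \<rho> \<Longrightarrow> k \<le> K
      \<Longrightarrow> dist ((T ^^ k) a) ((T ^^ k) b) < \<eta>"
    using X.uniform_equicontinuity[OF insert.prems(2), of K] by blast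
  obtain l where l: "\<forall>i\<in>I. dist ((T ^^ l) (a i)) ((T ^^ l) (b i)) < \<rho>"
    using insert.IH[OF _ \<rho>(1)] insert.prems(1) by auto
  have "\<pi> ((T ^^ l) (a j)) = \<pi> ((T ^^ l) (b j))"
    using insert.prems(1)[of j] by (simp add: pi_funpow)
  then obtain k where k: "k \<le> K" "dist ((T ^^ k) ((T ^^ l) (a j))) ((T ^^ k) ((T ^^ l) (b j))) < \<eta>"
    using K[of "(T ^^ l) (a j)" "(T ^^ l) (b j)"] insert.prems(1)[of j] by auto
  have "dist ((T ^^ (k + l)) (a i)) ((T ^^ (k + l)) (b i)) < \<eta>" if "i \<in> insert j I" for i
    using that k \<rho>(2)[of "(T ^^ l) (a i)" "(T ^^ l) (b i)" k] l insert.prems(1)[of i]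
    by (auto simp: funpow_add)
  then show ?case by blast
qed simp

text \<open>
  A small cover of a preimage by one set more than allowed has two members containing a pair of
  points of one fibre at distance at least \<open>\<delta>2\<close>. A time at which that pair is close merges
  the two members, and the preimage of some smaller open set is then covered by too few sets.
\<close>

lemma no_small_cover_Suc:
  assumes "\<delta>2 > 0" and fib: "\<And>W. openin (top_of_set Y) W \<Longrightarrow> W \<noteq> {} \<Longrightarrow>
      \<exists>a\<in>X. \<exists>b\<in>X. \<pi> a = \<pi> b \<and> \<pi> a \<in> W \<and> dist a b \<ge> \<delta>2"
    and "\<delta> > 0" and no: "\<And>W. openin (top_of_set Y) W \<Longrightarrow> W \<noteq> {} \<Longrightarrow> \<not> small_cover m \<delta> (X \<inter> \<pi> -` W)"
  obtains \<delta>' where "\<delta>' > 0"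
    "\<And>W. openin (top_of_set Y) W \<Longrightarrow> W \<noteq> {} \<Longrightarrow> \<not> small_cover (Suc m) \<delta>' (X \<inter> \<pi> -` W)"
proof -
  have "\<delta> / 3 > 0" using \<open>\<delta> > 0\<close> by simp
  obtain K where K: "\<And>a b. a \<in> X \<Longrightarrow> b \<in> X \<Longrightarrow> \<pi> a = \<pi> b \<Longrightarrow>
      \<exists>k\<le>K. dist ((T ^^ k) a) ((T ^^ k) b) < \<delta> / 3"
    using uniform_proximality[OF \<open>\<delta> / 3 > 0\<close>] by blast
  obtain \<rho> where \<rho>: "\<rho> > 0" "\<And>a b k. a \<in> X \<Longrightarrow> b \<in> X \<Longrightarrow> dist a b < \<rho> \<Longrightarrow> k \<le> K
      \<Longrightarrow> dist ((T ^^ k) a) ((T ^^ k) b) < \<delta> / 3"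
    using X.uniform_equicontinuity[OF \<open>\<delta> / 3 > 0\<close>, of K] by blast
  show thesis
  proof (rule that[of "min \<rho> \<delta>2"])
    show "min \<rho> \<delta>2 > 0" using \<rho> \<open>\<delta>2 > 0\<close> by simp
    fix W assume W: "openin (top_of_set Y) W" "W \<noteq> {}"
    show "\<not> small_cover (Suc m) (min \<rho> \<delta>2) (X \<inter> \<pi> -` W)"
    proof
      assume "small_cover (Suc m) (min \<rho> \<delta>2) (X \<inter> \<pi> -` W)"
      then obtain \<B> where B: "finite \<B>" "card \<B> \<le> Suc m" "X \<inter> \<pi> -` W \<subseteq> \<Union>\<B>"
        "\<forall>B\<in>\<B>. \<forall>a\<in>B. \<forall>b\<in>B. dist a b < min \<rho> \<delta>2"
        unfolding small_cover_def by (elim exE conjE)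
      obtain a b where ab: "a \<in> X" "b \<in> X" "\<pi> a = \<pi> b" "\<pi> a \<in> W" "dist a b \<ge> \<delta>2"
        using fib[OF W] by blast
      then have "a \<in> X \<inter> \<pi> -` W" "b \<in> X \<inter> \<pi> -` W" by auto
      then obtain P Q where P: "P \<in> \<B>" "a \<in> P" and Q: "Q \<in> \<B>" "b \<in> Q" using B(3) by blast
      have "P \<noteq> Q" using B(4) P Q ab by fastforce
      obtain k where k: "k \<le> K" "dist ((T ^^ k) a) ((T ^^ k) b) < \<delta> / 3"
        using K[OF ab(1-3)] by blast
      have near: "dist ((T ^^ k) c) ((T ^^ k) d) < \<delta> / 3"
        if "B \<in> \<B>" "c \<in> B" "d \<in> B" "c \<in> X" "d \<in> X" for B c d
        using \<rho>(2)[OF that(4,5) _ k(1)] B(4)[rule_format, OF that(1-3)] by simp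
      define \<C> where "\<C> = insert ((T ^^ k) ` (X \<inter> (P \<union> Q))) ((\<lambda>B. (T ^^ k) ` (X \<inter> B)) ` (\<B> - {P, Q}))"
      obtain V where V: "openin (top_of_set Y) V" "V \<noteq> {}" "\<And>y. y \<in> Y \<Longrightarrow> (S ^^ k) y \<in> V \<Longrightarrow> y \<in> W"
        using Y.preimage_contained[OF W, of k] by blast
      have "small_cover m \<delta> (X \<inter> \<pi> -` V)"
        unfolding small_cover_def
      proof (intro exI[of _ \<C>] conjI ballI)
        show "finite \<C>" using B(1) by (simp add: \<C>_def)
        have "card \<C> \<le> Suc (card (\<B> - {P, Q}))"
          unfolding \<C>_def using B(1) card_image_le[of "\<B> - {P, Q}" "\<lambda>B. (T ^^ k) ` (X \<inter> B)"]
          by (simp add: card_insert_if)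
        also have "card (\<B> - {P, Q}) = card \<B> - 2"
          using P Q \<open>P \<noteq> Q\<close> B(1) by (subst card_Diff_subset) auto
        also have "Suc (card \<B> - 2) \<le> m"
        proof -
          have "card {P, Q} \<le> card \<B>" by (rule card_mono) (use P Q B in auto)
          then show ?thesis using B(2) \<open>P \<noteq> Q\<close> by simp
        qed
        finally show "card \<C> \<le> m" .
        show "X \<inter> \<pi> -` V \<subseteq> \<Union>\<C>"
        proof
          fix x assume x: "x \<in> X \<inter> \<pi> -` V"
          then have "x \<in> (T ^^ k) ` X" using X.surj_funpow by auto
          then obtain x' where x': "x' \<in> X" "(T ^^ k) x' = x" by auto
          then have "\<pi> x' \<in> W" using V(3)[of "\<pi> x'"] pi_funpow[of x' k] x by auto
          then obtain B where "B \<in> \<B>" "x' \<in> B" using B(3) x' by blast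
          then show "x \<in> \<Union>\<C>"
            using x' by (cases "B = P \<or> B = Q") (auto simp: \<C>_def)
        qed
        fix C c d assume "C \<in> \<C>" "c \<in> C" "d \<in> C"
        then consider (merged) "c \<in> (T ^^ k) ` (X \<inter> (P \<union> Q))" "d \<in> (T ^^ k) ` (X \<inter> (P \<union> Q))"
          | (old) B where "B \<in> \<B>" "c \<in> (T ^^ k) ` (X \<inter> B)" "d \<in> (T ^^ k) ` (X \<inter> B)"
          unfolding \<C>_def by blast
        then show "dist c d < \<delta>"
        proof cases
          case old
          then obtain c' d' where "c' \<in> X \<inter> B" "d' \<in> X \<inter> B" "c = (T ^^ k) c'" "d = (T ^^ k) d'"
            by blast
          then show ?thesis using near[OF old(1), of c' d'] \<open>\<delta> > 0\<close> by auto
        next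
          case merged
          have key: "dist ((T ^^ k) p) ((T ^^ k) q) < \<delta>" if "p \<in> X \<inter> P" "q \<in> X \<inter> Q" for p q
          proof -
            have "dist ((T ^^ k) p) ((T ^^ k) a) < \<delta> / 3" using near[OF P(1), of p a] that P ab by auto
            moreover have "dist ((T ^^ k) b) ((T ^^ k) q) < \<delta> / 3"
              using near[OF Q(1), of b q] that Q ab by auto
            ultimately show ?thesis
              using k(2) dist_triangle[of "(T ^^ k) p" "(T ^^ k) q" "(T ^^ k) a"]
                dist_triangle[of "(T ^^ k) a" "(T ^^ k) q" "(T ^^ k) b"] by linarith
          qed
          obtain c' d' where cd: "c' \<in> X \<inter> (P \<union> Q)" "d' \<in> X \<inter> (P \<union> Q)" "c = (T ^^ k) c'" "d = (T ^^ k) d'"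
            using merged by blast
          consider "c' \<in> P" "d' \<in> P" | "c' \<in> Q" "d' \<in> Q" | "c' \<in> P" "d' \<in> Q" | "c' \<in> Q" "d' \<in> P"
            using cd by blast
          then show ?thesis
          proof cases
            case 1
            then show ?thesis using near[OF P(1), of c' d'] cd \<open>\<delta> > 0\<close> by auto
          next
            case 2
            then show ?thesis using near[OF Q(1), of c' d'] cd \<open>\<delta> > 0\<close> by auto
          next
            case 3
            then show ?thesis using key[of c' d'] cd by auto
          next
            case 4
            then show ?thesis using key[of d' c'] cd by (auto simp: dist_commute)
          qed
        qed
      qed
      with no[OF V(1,2)] show False by simp
    qed
  qed
qed

lemma no_small_cover:
  assumes "\<not> almost_one_to_one X \<pi>"
  shows "\<exists>\<delta>>0. \<forall>W. openin (top_of_set Y) W \<and> W \<noteq> {} \<longrightarrow> \<not> small_cover m \<delta> (X \<inter> \<pi> -` W)"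
proof (induction m)
  case 0
  have "\<not> small_cover 0 1 (X \<inter> \<pi> -` W)" if W: "openin (top_of_set Y) W" "W \<noteq> {}" for W
  proof -
    obtain y where "y \<in> W" "y \<in> Y" using W openin_subset[OF W(1)] by auto
    then have "X \<inter> \<pi> -` W \<noteq> {}" using pi_surj by auto
    then show ?thesis by (auto simp: small_cover_def)
  qed
  then show ?case by (intro exI[of _ 1]) auto
next
  case (Suc m)
  then obtain \<delta> where \<delta>: "\<delta> > 0"
    "\<And>W. openin (top_of_set Y) W \<Longrightarrow> W \<noteq> {} \<Longrightarrow> \<not> small_cover m \<delta> (X \<inter> \<pi> -` W)" by blast
  obtain \<delta>2 where \<delta>2: "\<delta>2 > 0" "\<And>W. openin (top_of_set Y) W \<Longrightarrow> W \<noteq> {} \<Longrightarrow>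
      \<exists>a\<in>X. \<exists>b\<in>X. \<pi> a = \<pi> b \<and> \<pi> a \<in> W \<and> dist a b \<ge> \<delta>2"
    using separated_fibres[OF assms] by blast
  show ?case
  proof (rule no_small_cover_Suc[OF \<delta>2 \<delta>])
    fix \<delta>' :: real assume "\<delta>' > 0"
      "\<And>W. openin (top_of_set Y) W \<Longrightarrow> W \<noteq> {} \<Longrightarrow> \<not> small_cover (Suc m) \<delta>' (X \<inter> \<pi> -` W)"
    then show ?case by (intro exI[of _ \<delta>']) simp
  qed
qed

lemma common_return_times:
  assumes "finite I" "z \<in> X" "\<And>i. i \<in> I \<Longrightarrow> x i \<in> X \<and> \<pi> (x i) = \<pi> ((T ^^ q i) z)" "\<epsilon> > 0"
  shows "\<exists>p\<ge>1. \<forall>i\<in>I. dist ((T ^^ p) (x i)) ((T ^^ q i) z) < \<epsilon> \<and>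
    dist ((T ^^ p) ((T ^^ q i) z)) ((T ^^ q i) z) < \<epsilon>"
proof -
  have "\<epsilon> / 2 > 0" using \<open>\<epsilon> > 0\<close> by simp
  define V where "V = X \<inter> (\<Inter>i\<in>I. X \<inter> (T ^^ q i) -` (X \<inter> ball ((T ^^ q i) z) (\<epsilon> / 2)))"
  have "openin (top_of_set X) V"
    unfolding V_def
  proof (cases "I = {}")
    case False
    then show "openin (top_of_set X) (X \<inter> (\<Inter>i\<in>I. X \<inter> (T ^^ q i) -` (X \<inter> ball ((T ^^ q i) z) (\<epsilon> / 2))))"
      using \<open>finite I\<close>
      by (intro openin_Int openin_INT2 X.openin_funpow_vimage openin_open_Int) auto
  qed simp
  moreover have "z \<in> V" using assms by (auto simp: V_def)
  ultimately obtain L where L: "\<And>x. x \<in> X \<Longrightarrow> \<exists>l\<le>L. (T ^^ l) x \<in> V"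
    using X.bounded_visit[of V] by blast
  obtain \<rho> where \<rho>: "\<rho> > 0" "\<And>a b k. a \<in> X \<Longrightarrow> b \<in> X \<Longrightarrow> dist a b < \<rho> \<Longrightarrow> k \<le> Suc L
      \<Longrightarrow> dist ((T ^^ k) a) ((T ^^ k) b) < \<epsilon> / 2"
    using X.uniform_equicontinuity[OF \<open>\<epsilon> / 2 > 0\<close>, of "Suc L"] by blast
  obtain k where k: "\<forall>i\<in>I. dist ((T ^^ k) (x i)) ((T ^^ k) ((T ^^ q i) z)) < \<rho>"
    using simultaneous_proximality[OF \<open>finite I\<close>, of x "\<lambda>i. (T ^^ q i) z" \<rho>] assms \<rho>(1) by auto
  obtain l where l: "l \<le> L" "(T ^^ l) ((T ^^ Suc k) z) \<in> V"
    using L[of "(T ^^ Suc k) z"] X.funpow_in[OF \<open>z \<in> X\<close>, of "Suc k"] by auto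
  define p where "p = Suc l + k"
  have "l + Suc k = p" by (simp add: p_def)
  then have pO: "(T ^^ p) z \<in> V" using l(2) by (metis comp_apply funpow_add)
  have "dist ((T ^^ p) (x i)) ((T ^^ q i) z) < \<epsilon> \<and> dist ((T ^^ p) ((T ^^ q i) z)) ((T ^^ q i) z) < \<epsilon>"
    if i: "i \<in> I" for i
  proof -
    have "(T ^^ p) ((T ^^ q i) z) = (T ^^ q i) ((T ^^ p) z)"
      by (metis add.commute comp_apply funpow_add)
    moreover have "(T ^^ p) z \<in> (T ^^ q i) -` (X \<inter> ball ((T ^^ q i) z) (\<epsilon> / 2))"
      using pO i unfolding V_def by blast
    ultimately have z: "dist ((T ^^ p) ((T ^^ q i) z)) ((T ^^ q i) z) < \<epsilon> / 2"
      by (simp add: dist_commute)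
    have "dist ((T ^^ Suc l) ((T ^^ k) (x i))) ((T ^^ Suc l) ((T ^^ k) ((T ^^ q i) z))) < \<epsilon> / 2"
      by (rule \<rho>(2)) (use k i l(1) assms in auto)
    then have "dist ((T ^^ p) (x i)) ((T ^^ p) ((T ^^ q i) z)) < \<epsilon> / 2"
      unfolding p_def funpow_add comp_apply .
    with z \<open>\<epsilon> > 0\<close> show ?thesis
      using dist_triangle[of "(T ^^ p) (x i)" "(T ^^ q i) z" "(T ^^ p) ((T ^^ q i) z)"] by linarith
  qed
  then show ?thesis by (intro exI[of _ p]) (simp add: p_def)
qed

lemma IP_set_near:
  assumes "finite I" "z \<in> X" and x: "\<And>i. i \<in> I \<Longrightarrow> x i \<in> X \<and> \<pi> (x i) = \<pi> ((T ^^ q i) z)" and "\<epsilon> > 0"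
  shows "IP_set {s \<in> {1..}. \<forall>i\<in>I. dist ((T ^^ s) (x i)) ((T ^^ q i) z) < \<epsilon>}"
proof -
  define w where "w i = (T ^^ q i) z" for i
  have w: "w i \<in> X" for i using \<open>z \<in> X\<close> by (simp add: w_def)
  define F where "F = {s \<in> {1..}. \<forall>i\<in>I. dist ((T ^^ s) (x i)) (w i) < \<epsilon> \<and> dist ((T ^^ s) (w i)) (w i) < \<epsilon>}"
  have "IP_set F"
  proof (rule IP_setI_extend)
    show "F \<subseteq> {1..}" by (auto simp: F_def)
    fix A assume A: "finite A" "A \<subseteq> insert 0 F"
    define D where "D = insert 1 ((\<lambda>(s, i). \<epsilon> - dist ((T ^^ s) (w i)) (w i)) ` (A \<times> I))"
    have D: "finite D" "D \<noteq> {}" using A(1) \<open>finite I\<close> by (auto simp: D_def)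
    have "\<forall>d\<in>D. d > 0" using A(2) \<open>\<epsilon> > 0\<close> by (auto simp: D_def F_def)
    then have tau: "Min D > 0" using D by simp
    have close: "dist ((T ^^ s) (w i)) (w i) + Min D \<le> \<epsilon>" if "s \<in> A" "i \<in> I" for s i
    proof -
      have "\<epsilon> - dist ((T ^^ s) (w i)) (w i) \<in> D" unfolding D_def using that by force
      from Min_le[OF D(1) this] show ?thesis by simp
    qed
    obtain N where N: "\<forall>s\<in>A. s \<le> N" using A(1) finite_nat_set_iff_bounded_le by blast
    obtain \<gamma> where \<gamma>: "\<gamma> > 0" "\<And>a b k. a \<in> X \<Longrightarrow> b \<in> X \<Longrightarrow> dist a b < \<gamma> \<Longrightarrow> k \<le> N
        \<Longrightarrow> dist ((T ^^ k) a) ((T ^^ k) b) < Min D"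
      using X.uniform_equicontinuity[OF tau, of N] by blast
    obtain p where p: "p \<ge> 1" "\<forall>i\<in>I. dist ((T ^^ p) (x i)) (w i) < \<gamma> \<and> dist ((T ^^ p) (w i)) (w i) < \<gamma>"
      using common_return_times[OF \<open>finite I\<close> \<open>z \<in> X\<close> x \<gamma>(1), of "\<lambda>i. i"] unfolding w_def by blast
    have step: "dist ((T ^^ (p + s)) v) (w i) < \<epsilon>"
      if "s \<in> A" "i \<in> I" "v \<in> X" "dist ((T ^^ p) v) (w i) < \<gamma>" for s i v
    proof -
      have "(T ^^ (p + s)) v = (T ^^ s) ((T ^^ p) v)" by (metis add.commute comp_apply funpow_add)
      moreover have "dist ((T ^^ s) ((T ^^ p) v)) ((T ^^ s) (w i)) < Min D"
        using \<gamma>(2)[of "(T ^^ p) v" "w i" s] that N w by auto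
      ultimately show ?thesis
        using close[OF that(1,2)] dist_triangle[of "(T ^^ (p + s)) v" "w i" "(T ^^ s) (w i)"] by simp
    qed
    have "\<forall>s\<in>A. p + s \<in> F" using step p x w by (auto simp: F_def)
    with p(1) show "\<exists>p\<ge>1. \<forall>s\<in>A. p + s \<in> F" by blast
  qed
  then show ?thesis by (rule IP_set_mono) (auto simp: F_def w_def)
qed

lemma IP_sensitive:
  assumes nao: "\<not> almost_one_to_one X \<pi>" and "n \<ge> 2"
  shows "tuplewise_IP_sensitive n X T"
proof -
  obtain \<delta> where \<delta>: "\<delta> > 0"
    "\<And>W. openin (top_of_set Y) W \<Longrightarrow> W \<noteq> {} \<Longrightarrow> \<not> small_cover (n - 1) \<delta> (X \<inter> \<pi> -` W)"
    using no_small_cover[OF nao, of "n - 1"] by blast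
  show ?thesis
    unfolding tuplewise_IP_sensitive_def
  proof (intro exI[of _ "\<delta> / 8"] conjI allI impI)
    show "\<delta> / 8 > 0" using \<delta> by simp
    fix U assume "openin (top_of_set X) U \<and> U \<noteq> {}"
    then have U: "openin (top_of_set X) U" "U \<noteq> {}" by auto
    have UX: "U \<subseteq> X" using openin_subset[OF U(1)] by simp
    obtain W where W: "openin (top_of_set Y) W" "W \<noteq> {}" "W \<subseteq> \<pi> ` U"
      using pi_semiopen[OF U] by blast
    obtain v where v: "\<forall>i\<in>{1..n}. v i \<in> X \<inter> \<pi> -` W"
      "\<forall>i j. 1 \<le> i \<and> i < j \<and> j \<le> n \<longrightarrow> dist (v i) (v j) \<ge> \<delta> / 2"
      using separated_points_if_no_small_cover[OF \<delta>(2)[OF W(1,2)], of n] \<open>n \<ge> 2\<close> by auto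
    obtain z where z: "z \<in> X" using U UX by auto
    have "\<exists>q. (T ^^ q) z \<in> (X \<inter> \<pi> -` W) \<inter> (X \<inter> ball (v i) (\<delta> / 16))" if "i \<in> {1..n}" for i
    proof -
      have "openin (top_of_set X) ((X \<inter> \<pi> -` W) \<inter> (X \<inter> ball (v i) (\<delta> / 16)))"
        by (rule openin_Int[OF openin_pi_vimage[OF W(1)] openin_open_Int[OF open_ball]])
      moreover have "v i \<in> (X \<inter> \<pi> -` W) \<inter> (X \<inter> ball (v i) (\<delta> / 16))"
        using v(1) that \<delta>(1) by auto
      ultimately obtain L where "\<And>x. x \<in> X \<Longrightarrow>
          \<exists>l\<le>L. (T ^^ l) x \<in> (X \<inter> \<pi> -` W) \<inter> (X \<inter> ball (v i) (\<delta> / 16))"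
        using X.bounded_visit[of "(X \<inter> \<pi> -` W) \<inter> (X \<inter> ball (v i) (\<delta> / 16))"] by blast
      with z show ?thesis by blast
    qed
    then obtain q where q: "\<And>i. i \<in> {1..n} \<Longrightarrow>
        (T ^^ q i) z \<in> (X \<inter> \<pi> -` W) \<inter> (X \<inter> ball (v i) (\<delta> / 16))" by metis
    then have "\<exists>u. u \<in> U \<and> \<pi> u = \<pi> ((T ^^ q i) z)" if "i \<in> {1..n}" for i
      using that W(3) by fastforce
    then obtain x where x: "\<And>i. i \<in> {1..n} \<Longrightarrow> x i \<in> U \<and> \<pi> (x i) = \<pi> ((T ^^ q i) z)" by metis
    show "\<exists>x. (\<forall>i\<in>{1..n}. x i \<in> U) \<and> IP_set {k \<in> {1..}.
        Min {dist ((T ^^ k) (x i)) ((T ^^ k) (x j)) |i j. 1 \<le> i \<and> i < j \<and> j \<le> n} > \<delta> / 8}"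
    proof (intro exI[of _ x] conjI ballI)
      show "x i \<in> U" if "i \<in> {1..n}" for i using x[OF that] by simp
      have "IP_set {s \<in> {1..}. \<forall>i\<in>{1..n}. dist ((T ^^ s) (x i)) ((T ^^ q i) z) < \<delta> / 16}"
        by (rule IP_set_near) (use z x UX \<delta>(1) in auto)
      then show "IP_set {k \<in> {1..}.
        Min {dist ((T ^^ k) (x i)) ((T ^^ k) (x j)) |i j. 1 \<le> i \<and> i < j \<and> j \<le> n} > \<delta> / 8}"
      proof (rule IP_set_mono)
        have "Min {dist ((T ^^ s) (x i)) ((T ^^ s) (x j)) |i j. 1 \<le> i \<and> i < j \<and> j \<le> n} > \<delta> / 8"
          if s: "\<forall>i\<in>{1..n}. dist ((T ^^ s) (x i)) ((T ^^ q i) z) < \<delta> / 16" for s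
        proof -
          let ?D = "{dist ((T ^^ s) (x i)) ((T ^^ s) (x j)) |i j. 1 \<le> i \<and> i < j \<and> j \<le> n}"
          have "?D \<subseteq> (\<lambda>(i, j). dist ((T ^^ s) (x i)) ((T ^^ s) (x j))) ` ({1..n} \<times> {1..n})"
            by force
          then have "finite ?D" by (rule finite_subset) simp
          moreover have "?D \<noteq> {}"
          using \<open>n \<ge> 2\<close> by simp (rule exI[of _ 1], rule exI[of _ 2], simp)
          moreover have "dist ((T ^^ s) (x i)) ((T ^^ s) (x j)) > \<delta> / 8"
            if ij: "1 \<le> i" "i < j" "j \<le> n" for i j
          proof -
            have near: "dist ((T ^^ s) (x l)) (v l) < \<delta> / 8" if "l \<in> {1..n}" for l
              using dist_triangle[of "(T ^^ s) (x l)" "v l" "(T ^^ q l) z"] s q[OF that] that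
              by (fastforce simp: dist_commute)
            have "dist (v i) (v j) \<ge> \<delta> / 2" using v(2) ij by blast
            moreover have "dist ((T ^^ s) (x i)) (v i) < \<delta> / 8" "dist ((T ^^ s) (x j)) (v j) < \<delta> / 8"
              using near ij by auto
            ultimately show ?thesis
              using dist_triangle[of "v i" "v j" "(T ^^ s) (x i)"]
                dist_triangle[of "(T ^^ s) (x i)" "v j" "(T ^^ s) (x j)"] \<delta>(1)
                dist_commute[of "v i" "(T ^^ s) (x i)"] by linarith
          qed
          ultimately show ?thesis by (subst Min_gr_iff) auto
        qed
        then show "{s \<in> {1..}. \<forall>i\<in>{1..n}. dist ((T ^^ s) (x i)) ((T ^^ q i) z) < \<delta> / 16} \<subseteq>
            {k \<in> {1..}. Min {dist ((T ^^ k) (x i)) ((T ^^ k) (x j)) |i j. 1 \<le> i \<and> i < j \<and> j \<le> n} > \<delta> / 8}"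
          by blast
      qed blast
    qed
  qed
qed

end

theorem theorem3p6:
  fixes X :: "'a::metric_space set" and T :: "'a \<Rightarrow> 'a"
    and Y :: "'b::metric_space set" and S :: "'b \<Rightarrow> 'b"
    and \<pi> :: "'a \<Rightarrow> 'b"
  assumes "minimal_system X T"
    and "minimal_system Y S"
    and "factor_map X T Y S \<pi>"
    and "proximal_map X T \<pi>"
    and "\<not> almost_one_to_one X \<pi>"
  shows "\<forall>n\<ge>2. tuplewise_IP_sensitive n X T"
proof (intro allI impI)
  fix n :: nat assume "n \<ge> 2"
  interpret proximal_minimal_factor X T Y S \<pi>
    using assms by unfold_locales
  show "tuplewise_IP_sensitive n X T" by (rule IP_sensitive) fact+
qed

end
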